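(* Let $H$ be a regular Fourier hypergroup with left Haar measure $m_H$. Then $\mathcal{L}A(H)=L^1(H)\cap A(H)$ is a dense ideal in $A(H)$ (with pointwise multiplication, and density with respect to $\|\cdot\|_{A(H)}$).
   Context: A hypergroup (in the sense of Jewett) is a nonempty locally compact Hausdorff space $H$ together with a bilinear associative product (convolution) $*$ on the space $M(H)$ of bounded complex Radon measures such that: $\delta_x*\delta_y$ is a compactly supported probability measure for all $x,y\in H$; the convolution is continuous on nonnegative measures in the weak topology given by the test functions $C_c(H)\cup\{1\}$; $(x,y)\mapsto \mathrm{supp}(\delta_x*\delta_y)$ is continuous into the compact subsets of $H$ with the Michael topology; there is an identity $e\in H$ with $\delta_e*\delta_x=\delta_x*\delta_e=\delta_x$; there is a homeomorphic involution $x\mapsto\check{x}$ with $(\delta_x*\delta_y)\check{\ }=\delta_{\check y}*\delta_{\check x}$, and $e\in\mathrm{supp}(\delta_x*\delta_y)$ if and only if $x=\check y$. All hypergroups are assumed to admit a left Haar measure $m_H$ (a nonzero positive Radon measure with $\int f(xy)\,dm_H(y)=\int f\,dm_H$ for $f\in C_c(H)$, $x\in H$), and $dt$ means $dm_H(t)$. Here $f(xy):=\int_H f\,d(\delta_x*\delta_y)$. $L^p(H)=L^p(H,m_H)$. For $f\in L^1(H)$, $g\in L^p(H)$, $(f*g)(x)=\int_H f(y)\,g(\check y x)\,dy$. Put $\tilde f(x)=\overline{f(\check x)}$. The left regular representation $\lambda$ on $L^2(H)$ is $\lambda(x)f(y)=f(\check x y)$, extended to $L^1(H)$ by integration. $C_\lambda^*(H)$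 is the completion of $L^1(H)$ in the norm $\|f\|_{C^*_\lambda(H)}=\|\lambda(f)\|_{\mathcal{B}(L^2(H))}$, and $B_\lambda(H)=C_\lambda^*(H)^*$, whose elements are realized as functions $u$ on $H$ via $\langle u,f\rangle=\int_H u f\,dm_H$, $f\in L^1(H)$. The Fourier space $A(H)$ is the norm-closed subspace of $B_\lambda(H)$ spanned by $\{f*\tilde f: f\in C_c(H)\}$, with the norm $\|\cdot\|_{A(H)}$ of $B_\lambda(H)$; its elements are continuous functions vanishing at infinity. $H$ is a regular Fourier hypergroup if $A(H)$ is a Banach algebra with its original norm $\|\cdot\|_{A(H)}$ and pointwise product. *)

theory Defs
  imports "HOL-Probability.Giry_Monad"
begin

section \<open>Radon measures\<close>

definition radon_measure :: "'a::topological_space measure \<Rightarrow> bool" where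
  "radon_measure M \<longleftrightarrow>
     sets M = sets borel \<and>
     (\<forall>K. compact K \<longrightarrow> emeasure M K < \<infinity>) \<and>
     (\<forall>A\<in>sets borel. emeasure M A = (INF U\<in>{U. open U \<and> A \<subseteq> U}. emeasure M U)) \<and>
     (\<forall>U. open U \<longrightarrow> emeasure M U = (SUP K\<in>{K. compact K \<and> K \<subseteq> U}. emeasure M K))"

text \<open>
  Complex measures are represented as set functions that are 0 outside the Borel sets, so that
  equality of measures is equality of functions and the vector space operations are pointwise.
\<close>

definition complex_borel_measure :: "('a::topological_space set \<Rightarrow> complex) \<Rightarrow> bool" where
  "complex_borel_measure \<mu> \<longleftrightarrow>
     (\<forall>A. A \<notin> sets borel \<longrightarrow> \<mu> A = 0) \<and>
     (\<forall>A::nat \<Rightarrow> 'a set. range A \<subseteq> sets borel \<longrightarrow> disjoint_family A \<longrightarrow>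
        (\<lambda>n. \<mu> (A n)) sums \<mu> (\<Union>n. A n))"

definition total_variation :: "('a::topological_space set \<Rightarrow> complex) \<Rightarrow> 'a measure" where
  "total_variation \<mu> = measure_of UNIV (sets borel)
     (\<lambda>A. SUP P\<in>{P. finite P \<and> disjoint P \<and> P \<subseteq> sets borel \<and> \<Union>P = A}.
             \<Sum>E\<in>P. ennreal (cmod (\<mu> E)))"

definition radon_measures :: "('a::topological_space set \<Rightarrow> complex) set" where
  "radon_measures = {\<mu>. complex_borel_measure \<mu> \<and> radon_measure (total_variation \<mu>)}"

definition nonneg_radon_measures :: "('a::topological_space set \<Rightarrow> complex) set" where
  "nonneg_radon_measures = {\<mu> \<in> radon_measures. \<forall>A. \<mu> A \<in> \<real>\<^sub>\<ge>\<^sub>0}"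

definition pos_measure :: "('a::topological_space set \<Rightarrow> complex) \<Rightarrow> 'a measure" where
  \<comment> \<open>a nonnegative set function as a measure in the library's sense\<close>
  "pos_measure \<mu> = measure_of UNIV (sets borel) (\<lambda>A. ennreal (Re (\<mu> A)))"

definition dirac :: "'a::topological_space \<Rightarrow> 'a set \<Rightarrow> complex" where
  "dirac x = (\<lambda>A. complex_of_real (measure (return borel x) A))"

definition measure_support :: "'a::topological_space measure \<Rightarrow> 'a set" where
  "measure_support M = {x. \<forall>U. open U \<longrightarrow> x \<in> U \<longrightarrow> emeasure M U \<noteq> 0}"

section \<open>Topologies\<close>

definition Cc :: "('a::topological_space \<Rightarrow> complex) set" where
  "Cc = {f. continuous_on UNIV f \<and> compact (closure {x. f x \<noteq> 0})}"

definition weak_topology :: "('a::topological_space set \<Rightarrow> complex) topology" where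
  \<comment> \<open>on the nonnegative measures: the coarsest topology making the integrals of all functions
     in \<open>Cc\<close> and of the constant 1 continuous\<close>
  "weak_topology = topology_generated_by
     {{\<mu> \<in> nonneg_radon_measures. (LINT t|pos_measure \<mu>. f t) \<in> U} |f U.
        f \<in> Cc \<union> {\<lambda>_. 1} \<and> open U}"

definition michael_topology :: "'a::topological_space set topology" where
  \<comment> \<open>on the nonempty compact subsets\<close>
  "michael_topology = topology_generated_by
     {{K. compact K \<and> K \<inter> U \<noteq> {} \<and> K \<subseteq> V} |U V. open U \<and> open V}"

section \<open>Hypergroups\<close>

text \<open>
  \<open>conv\<close> is the convolution of bounded complex Radon measures; its values outside
  \<open>radon_measures\<close> are irrelevant. The space is nonempty because it is a type.
\<close>

locale hypergroup =
  fixes conv :: "('a::t2_space set \<Rightarrow> complex) \<Rightarrow> ('a set \<Rightarrow> complex) \<Rightarrow> 'a set \<Rightarrow> complex"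
    and e :: 'a
    and invol :: "'a \<Rightarrow> 'a"
  assumes locally_compact: "locally_compact_space (euclidean :: 'a topology)"
    and conv_closed: "\<lbrakk>\<mu> \<in> radon_measures; \<nu> \<in> radon_measures\<rbrakk> \<Longrightarrow> conv \<mu> \<nu> \<in> radon_measures"
    and conv_linear_left:
      "\<lbrakk>\<mu> \<in> radon_measures; \<mu>' \<in> radon_measures; \<nu> \<in> radon_measures\<rbrakk> \<Longrightarrow>
         conv (\<lambda>A. a * \<mu> A + b * \<mu>' A) \<nu> = (\<lambda>A. a * conv \<mu> \<nu> A + b * conv \<mu>' \<nu> A)"
    and conv_linear_right:
      "\<lbrakk>\<mu> \<in> radon_measures; \<nu> \<in> radon_measures; \<nu>' \<in> radon_measures\<rbrakk> \<Longrightarrow>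
         conv \<mu> (\<lambda>A. a * \<nu> A + b * \<nu>' A) = (\<lambda>A. a * conv \<mu> \<nu> A + b * conv \<mu> \<nu>' A)"
    and conv_assoc:
      "\<lbrakk>\<mu> \<in> radon_measures; \<nu> \<in> radon_measures; \<rho> \<in> radon_measures\<rbrakk> \<Longrightarrow>
         conv (conv \<mu> \<nu>) \<rho> = conv \<mu> (conv \<nu> \<rho>)"
    and conv_dirac_nonneg: "conv (dirac x) (dirac y) \<in> nonneg_radon_measures"
    and conv_dirac_prob: "prob_space (pos_measure (conv (dirac x) (dirac y)))"
    and conv_dirac_compact: "compact (measure_support (pos_measure (conv (dirac x) (dirac y))))"
    and conv_continuous:
      "continuous_map (prod_topology weak_topology weak_topology) weak_topology
         (\<lambda>(\<mu>, \<nu>). conv \<mu> \<nu>)"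
    and support_continuous:
      "continuous_map euclidean michael_topology
         (\<lambda>(x, y). measure_support (pos_measure (conv (dirac x) (dirac y))))"
    and conv_id_left: "conv (dirac e) (dirac x) = dirac x"
    and conv_id_right: "conv (dirac x) (dirac e) = dirac x"
    and invol_homeomorphic: "homeomorphism UNIV UNIV invol invol"
    and conv_invol:
      "(\<lambda>A. conv (dirac x) (dirac y) (invol -` A)) = conv (dirac (invol y)) (dirac (invol x))"
    and id_in_support:
      "e \<in> measure_support (pos_measure (conv (dirac x) (dirac y))) \<longleftrightarrow> x = invol y"
begin

definition product_eval :: "('a \<Rightarrow> complex) \<Rightarrow> 'a \<Rightarrow> 'a \<Rightarrow> complex" where
  \<comment> \<open>the value written \<open>f(xy)\<close>\<close>
  "product_eval f x y = (LINT t|pos_measure (conv (dirac x) (dirac y)). f t)"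

definition tilde :: "('a \<Rightarrow> complex) \<Rightarrow> 'a \<Rightarrow> complex" where
  "tilde f = (\<lambda>x. cnj (f (invol x)))"

definition translation :: "'a \<Rightarrow> ('a \<Rightarrow> complex) \<Rightarrow> 'a \<Rightarrow> complex" where
  \<comment> \<open>the operator \<open>\<lambda>(x)\<close> of the left regular representation\<close>
  "translation x f = (\<lambda>y. product_eval f (invol x) y)"

end

locale haar_hypergroup = hypergroup conv e invol
  for conv :: "('a::t2_space set \<Rightarrow> complex) \<Rightarrow> ('a set \<Rightarrow> complex) \<Rightarrow> 'a set \<Rightarrow> complex"
    and e :: 'a
    and invol :: "'a \<Rightarrow> 'a" +
  fixes haar :: "'a measure"
  assumes haar_radon: "radon_measure haar"
    and haar_nonzero: "emeasure haar UNIV \<noteq> 0"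
    and haar_left_invariant:
      "f \<in> Cc \<Longrightarrow> (LINT y|haar. product_eval f x y) = (LINT y|haar. f y)"
begin

definition L1 :: "('a \<Rightarrow> complex) set" where
  "L1 = {f. integrable haar f}"

definition L2 :: "('a \<Rightarrow> complex) set" where
  "L2 = {f \<in> borel_measurable haar. integrable haar (\<lambda>x. (cmod (f x))\<^sup>2)}"

definition L2_norm :: "('a \<Rightarrow> complex) \<Rightarrow> real" where
  "L2_norm f = sqrt (LINT x|haar. (cmod (f x))\<^sup>2)"

definition fun_conv :: "('a \<Rightarrow> complex) \<Rightarrow> ('a \<Rightarrow> complex) \<Rightarrow> 'a \<Rightarrow> complex" where
  "fun_conv f g = (\<lambda>x. LINT y|haar. f y * product_eval g (invol y) x)"

definition regular_rep :: "('a \<Rightarrow> complex) \<Rightarrow> ('a \<Rightarrow> complex) \<Rightarrow> 'a \<Rightarrow> complex" where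
  \<comment> \<open>the operator \<open>\<lambda>(f)\<close>, the integral of \<open>f(x) \<lambda>(x)\<close>\<close>
  "regular_rep f g = (\<lambda>y. LINT x|haar. f x * translation x g y)"

definition cstar_norm :: "('a \<Rightarrow> complex) \<Rightarrow> real" where
  "cstar_norm f = (SUP g\<in>{g \<in> L2. L2_norm g \<le> 1}. L2_norm (regular_rep f g))"

text \<open>
  The completion \<open>cstar\<close> of \<open>L1\<close> is given by Cauchy sequences; its elements are
  not identified with each other, but a bounded linear functional agrees on sequences at distance 0.
  \<open>L1\<close> is embedded as the constant sequences.
\<close>

definition cstar :: "(nat \<Rightarrow> 'a \<Rightarrow> complex) set" where
  "cstar = {F. (\<forall>n. F n \<in> L1) \<and>
     (\<forall>\<epsilon>>0. \<exists>N. \<forall>m\<ge>N. \<forall>n\<ge>N. cstar_norm (\<lambda>x. F m x - F n x) < \<epsilon>)}"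

definition completion_norm :: "(nat \<Rightarrow> 'a \<Rightarrow> complex) \<Rightarrow> real" where
  "completion_norm F = lim (\<lambda>n. cstar_norm (F n))"

definition cstar_dual :: "((nat \<Rightarrow> 'a \<Rightarrow> complex) \<Rightarrow> complex) set" where
  "cstar_dual = {\<Phi>.
     (\<forall>F\<in>cstar. \<forall>G\<in>cstar. \<Phi> (\<lambda>n x. F n x + G n x) = \<Phi> F + \<Phi> G) \<and>
     (\<forall>c. \<forall>F\<in>cstar. \<Phi> (\<lambda>n x. c * F n x) = c * \<Phi> F) \<and>
     (\<exists>C. \<forall>F\<in>cstar. cmod (\<Phi> F) \<le> C * completion_norm F)}"

definition dual_norm :: "((nat \<Rightarrow> 'a \<Rightarrow> complex) \<Rightarrow> complex) \<Rightarrow> real" where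
  "dual_norm \<Phi> = (SUP F\<in>{F \<in> cstar. completion_norm F \<le> 1}. cmod (\<Phi> F))"

definition realizes :: "('a \<Rightarrow> complex) \<Rightarrow> ((nat \<Rightarrow> 'a \<Rightarrow> complex) \<Rightarrow> complex) \<Rightarrow> bool" where
  "realizes u \<Phi> \<longleftrightarrow>
     (\<forall>f\<in>L1. integrable haar (\<lambda>x. u x * f x) \<and> \<Phi> (\<lambda>_. f) = (LINT x|haar. u x * f x))"

definition B_lambda :: "('a \<Rightarrow> complex) set" where
  "B_lambda = {u. \<exists>\<Phi>\<in>cstar_dual. realizes u \<Phi>}"

definition B_norm :: "('a \<Rightarrow> complex) \<Rightarrow> real" where
  \<comment> \<open>By density of \<open>L1\<close>, the functionals realized by \<open>u\<close> all agree on \<open>cstar\<close>, so the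
     infimum is over a single value.\<close>
  "B_norm u = (INF \<Phi>\<in>{\<Phi> \<in> cstar_dual. realizes u \<Phi>}. dual_norm \<Phi>)"

definition fourier_span :: "('a \<Rightarrow> complex) set" where
  "fourier_span = {\<lambda>x. \<Sum>i<n. c i * fun_conv (f i) (tilde (f i)) x |n c f.
     \<forall>i<(n::nat). f i \<in> Cc}"

definition fourier_space :: "('a \<Rightarrow> complex) set" where
  \<comment> \<open>The elements of \<open>B_lambda\<close> are determined only up to local null sets; the elements of
     the Fourier space are taken to be their continuous representatives. The closure is formed
     inside \<open>B_lambda\<close> because \<open>B_norm\<close> is meaningful only there.\<close>
  "fourier_space = {u \<in> B_lambda. continuous_on UNIV u \<and>
     (\<forall>\<epsilon>>0. \<exists>v \<in> fourier_span \<inter> B_lambda. B_norm (\<lambda>x. u x - v x) < \<epsilon>)}"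

end

section \<open>Normed algebras of functions\<close>

definition function_subspace :: "('a \<Rightarrow> complex) set \<Rightarrow> bool" where
  "function_subspace V \<longleftrightarrow>
     (\<lambda>_. 0) \<in> V \<and>
     (\<forall>u\<in>V. \<forall>v\<in>V. (\<lambda>x. u x + v x) \<in> V) \<and>
     (\<forall>c. \<forall>u\<in>V. (\<lambda>x. c * u x) \<in> V)"

definition banach_function_algebra ::
    "('a \<Rightarrow> complex) set \<Rightarrow> (('a \<Rightarrow> complex) \<Rightarrow> real) \<Rightarrow> bool" where
  "banach_function_algebra V N \<longleftrightarrow>
     function_subspace V \<and>
     (\<forall>u\<in>V. 0 \<le> N u \<and> (N u = 0 \<longleftrightarrow> u = (\<lambda>_. 0))) \<and>
     (\<forall>c. \<forall>u\<in>V. N (\<lambda>x. c * u x) = cmod c * N u) \<and>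
     (\<forall>u\<in>V. \<forall>v\<in>V. N (\<lambda>x. u x + v x) \<le> N u + N v) \<and>
     (\<forall>F::nat \<Rightarrow> 'a \<Rightarrow> complex. (\<forall>n. F n \<in> V) \<longrightarrow>
        (\<forall>\<epsilon>>0. \<exists>M. \<forall>m\<ge>M. \<forall>n\<ge>M. N (\<lambda>x. F m x - F n x) < \<epsilon>) \<longrightarrow>
        (\<exists>u\<in>V. (\<lambda>n. N (\<lambda>x. F n x - u x)) \<longlonglongrightarrow> 0)) \<and>
     (\<forall>u\<in>V. \<forall>v\<in>V. (\<lambda>x. u x * v x) \<in> V \<and> N (\<lambda>x. u x * v x) \<le> N u * N v)"

definition function_ideal :: "('a \<Rightarrow> complex) set \<Rightarrow> ('a \<Rightarrow> complex) set \<Rightarrow> bool" where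
  "function_ideal I V \<longleftrightarrow> I \<subseteq> V \<and> function_subspace I \<and>
     (\<forall>u\<in>V. \<forall>v\<in>I. (\<lambda>x. u x * v x) \<in> I)"

definition norm_dense ::
    "(('a \<Rightarrow> complex) \<Rightarrow> real) \<Rightarrow> ('a \<Rightarrow> complex) set \<Rightarrow> ('a \<Rightarrow> complex) set \<Rightarrow> bool" where
  "norm_dense N D V \<longleftrightarrow> D \<subseteq> V \<and> (\<forall>u\<in>V. \<forall>\<epsilon>>0. \<exists>v\<in>D. N (\<lambda>x. u x - v x) < \<epsilon>)"

section \<open>Regular Fourier hypergroups\<close>

locale regular_fourier_hypergroup = haar_hypergroup +
  assumes fourier_algebra: "banach_function_algebra fourier_space B_norm"

definition (in haar_hypergroup) lebesgue_fourier :: "('a \<Rightarrow> complex) set" where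
  "lebesgue_fourier = L1 \<inter> fourier_space"

end

theory Submission
  imports Defs
begin

text \<open>
  The intersection is an ideal because the Fourier space \<open>A\<close> is an algebra by assumption and because
  an element of \<open>B_lambda\<close> multiplies \<open>L1\<close> into \<open>L1\<close>: integrability of the product is part of what it
  means to realize a functional (\<open>B_lambda_mult_L1\<close>).

  For density, \<open>A\<close> is by definition the closure of the span of the functions \<open>f * f~\<close> with \<open>f\<close>
  continuous of compact support, so it suffices that these functions are continuous and integrable
  (\<open>fun_conv_continuous\<close>, \<open>fun_conv_integrable\<close>). Continuity holds because the left translates
  \<open>g(invol(y) x)\<close> of a test function are jointly continuous in \<open>(y, x)\<close>, and the integration over \<open>y\<close> only
  involves the compact support of \<open>f\<close>. Joint continuity in turn expresses the weak continuity of the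
  convolution of measures along the weakly continuous map sending a point to its unit mass.

  Integrability is the estimate \<open>\<parallel>f * g\<parallel>\<^sub>1 \<le> \<parallel>f\<parallel>\<^sub>1 \<parallel>k\<parallel>\<^sub>1\<close> with \<open>k = |f| + |g|\<close>, which comes from
  exchanging the order of integration and from left invariance. The Haar measure need not be
  \<open>\<sigma>\<close>-finite, and a continuous function on the product space need not be measurable for the product
  \<open>\<sigma>\<close>-algebra, so the exchange is made by hand (\<open>nn_integral_compact_parameter_integral_le\<close>). On a
  compact set of points \<open>x\<close> the integral over \<open>y\<close> is within any prescribed error of a finite
  combination of translates, each of which has integral \<open>\<parallel>k\<parallel>\<^sub>1\<close>. The passage from compact sets to the
  whole space uses inner regularity on open sets (\<open>radon_nn_integral_le_if_compact\<close>).
\<close>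

section \<open>Integration against Radon measures\<close>

lemma
  assumes "radon_measure M"
  shows radon_measure_sets: "sets M = sets borel"
    and radon_measure_compact_finite: "compact K \<Longrightarrow> emeasure M K < \<infinity>"
    and radon_measure_open_inner:
      "open U \<Longrightarrow> emeasure M U = (SUP K\<in>{K. compact K \<and> K \<subseteq> U}. emeasure M K)"
  using assms by (auto simp: radon_measure_def)

lemma radon_measure_compact_sets:
  fixes M :: "'a::t2_space measure"
  assumes "radon_measure M" "compact C"
  shows "C \<in> sets M"
  using assms by (simp add: radon_measure_sets borel_closed compact_imp_closed)

lemma radon_measure_measurable:
  assumes "radon_measure M" "continuous_on UNIV g"
  shows "g \<in> borel_measurable M"
  using borel_measurable_continuous_onI[OF assms(2)] radon_measure_sets[OF assms(1)]
  by (simp cong: measurable_cong_sets)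

text \<open>
  A Radon measure is inner regular on open sets only, and a continuous function enters through its
  open superlevel sets. Markov's inequality on compact subsets makes each set \<open>{\<phi> > 1/n}\<close> of finite
  measure, so compact subsets exhaust it up to a null set. Hence \<open>\<phi>\<close> vanishes almost everywhere outside
  an increasing union of compact sets, and monotone convergence applies.
\<close>
lemma radon_nn_integral_le_if_compact:
  fixes M :: "'a::t2_space measure" and \<phi> :: "'a \<Rightarrow> real"
  assumes M: "radon_measure M"
    and cont: "continuous_on UNIV \<phi>"
    and compact: "\<And>C. compact C \<Longrightarrow> (\<integral>\<^sup>+x\<in>C. ennreal (\<phi> x) \<partial>M) \<le> ennreal B"
  shows "(\<integral>\<^sup>+x. ennreal (\<phi> x) \<partial>M) \<le> ennreal B"
proof -
  note [measurable] = radon_measure_measurable[OF M cont]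
  note csets = radon_measure_compact_sets[OF M]
  define U where "U n = {x. 1 / real (Suc n) < \<phi> x}" for n
  have openU: "open (U n)" for n
    unfolding U_def by (intro open_Collect_less continuous_on_const cont)
  have Usets: "U n \<in> sets M" for n
    using openU[of n] radon_measure_sets[OF M] by simp
  have Ufin: "emeasure M (U n) < \<infinity>" for n
  proof -
    have "emeasure M C \<le> ennreal (real (Suc n)) * ennreal B" if C: "compact C" "C \<subseteq> U n" for C
    proof -
      have "emeasure M C = (\<integral>\<^sup>+x\<in>C. 1 \<partial>M)"
        using csets[OF C(1)] by simp
      also have "\<dots> \<le> (\<integral>\<^sup>+x. ennreal (real (Suc n)) * (ennreal (\<phi> x) * indicator C x) \<partial>M)"
      proof (intro nn_integral_mono)
        fix x
        have "1 \<le> ennreal (real (Suc n)) * ennreal (\<phi> x)" if "x \<in> C"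
        proof -
          have "1 \<le> real (Suc n) * \<phi> x"
            using that C(2) by (auto simp: U_def field_simps dest!: subsetD)
          then have "ennreal 1 \<le> ennreal (real (Suc n) * \<phi> x)" by (rule ennreal_leI)
          then show ?thesis by (subst ennreal_mult'[symmetric]) auto
        qed
        then show "1 * indicator C x
            \<le> ennreal (real (Suc n)) * (ennreal (\<phi> x) * indicator C x)"
          by (cases "x \<in> C") simp_all
      qed
      also have "\<dots> = ennreal (real (Suc n)) * (\<integral>\<^sup>+x\<in>C. ennreal (\<phi> x) \<partial>M)"
        using csets[OF C(1)] by (intro nn_integral_cmult) auto
      also have "\<dots> \<le> ennreal (real (Suc n)) * ennreal B"
        by (intro mult_left_mono compact C(1)) simp
      finally show ?thesis .
    qed
    then have "emeasure M (U n) \<le> ennreal (real (Suc n)) * ennreal B"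
      unfolding radon_measure_open_inner[OF M openU] by (auto intro!: SUP_least)
    then show ?thesis
      by (rule le_less_trans) (simp add: ennreal_mult_less_top)
  qed
  have "\<exists>C :: nat \<Rightarrow> 'a set. (\<forall>k. compact (C k) \<and> C k \<subseteq> U n) \<and> emeasure M (U n) = (SUP k. emeasure M (C k))"
    for n
  proof -
    have "\<exists>g::nat \<Rightarrow> ennreal. range g \<subseteq> emeasure M ` {K. compact K \<and> K \<subseteq> U n} \<and>
        (SUP K\<in>{K. compact K \<and> K \<subseteq> U n}. emeasure M K) = (SUP k. g k)"
      by (rule ennreal_SUP_countable_SUP) auto
    then obtain g :: "nat \<Rightarrow> ennreal"
      where g: "range g \<subseteq> emeasure M ` {K. compact K \<and> K \<subseteq> U n}"
        and eq: "emeasure M (U n) = (SUP k. g k)"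
      unfolding radon_measure_open_inner[OF M openU] by blast
    have "\<forall>k. \<exists>K. compact K \<and> K \<subseteq> U n \<and> g k = emeasure M K"
      using g by (auto simp: image_subset_iff image_iff)
    then obtain C where *: "\<forall>k. compact (C k) \<and> C k \<subseteq> U n \<and> g k = emeasure M (C k)"
      by metis
    with eq have "emeasure M (U n) = (SUP k. emeasure M (C k))" by (simp add: image_def)
    with * show ?thesis by blast
  qed
  then have "\<exists>C :: nat \<Rightarrow> nat \<Rightarrow> 'a set. \<forall>n. (\<forall>k. compact (C n k) \<and> C n k \<subseteq> U n)
      \<and> emeasure M (U n) = (SUP k. emeasure M (C n k))"
    by (intro choice allI)
  then obtain C :: "nat \<Rightarrow> nat \<Rightarrow> 'a set"
    where C: "\<And>n k. compact (C n k)" "\<And>n k. C n k \<subseteq> U n"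
      and supC: "\<And>n. emeasure M (U n) = (SUP k. emeasure M (C n k))"
    by blast
  \<comment> \<open>The doubly indexed family is enumerated by the pairing function to get an increasing sequence.\<close>
  define D where "D j = (\<Union>i<j. case prod_decode i of (n, k) \<Rightarrow> C n k)" for j
  have D: "compact (D j)" for j
    unfolding D_def by (intro compact_UN) (auto simp: C split: prod.split)
  have incD: "incseq D"
    unfolding D_def by (intro monoI UN_mono) auto
  define S where "S = (\<Union>j. D j)"
  have Ssets [measurable]: "S \<in> sets M"
    unfolding S_def using csets[OF D] by auto
  have CS: "C n k \<subseteq> S" for n k
  proof -
    have "C n k \<subseteq> D (Suc (prod_encode (n, k)))"
      unfolding D_def by (rule SUP_upper2[of "prod_encode (n, k)"]) auto
    then show ?thesis unfolding S_def by blast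
  qed
  have null: "emeasure M (U n - S) = 0" for n
  proof -
    have "emeasure M (U n) \<le> emeasure M (U n \<inter> S)"
      unfolding supC[of n] using C(2) CS Usets
      by (intro SUP_least emeasure_mono) auto
    moreover have "emeasure M (U n \<inter> S) \<le> emeasure M (U n)"
      using Usets by (intro emeasure_mono) auto
    ultimately have eq: "emeasure M (U n \<inter> S) = emeasure M (U n)" by simp
    have "emeasure M (U n - S) = emeasure M (U n - (U n \<inter> S))"
      by (simp add: Diff_Int)
    also have "\<dots> = emeasure M (U n) - emeasure M (U n \<inter> S)"
      using Usets Ssets Ufin[of n] eq by (intro emeasure_Diff) auto
    \<comment> \<open>Finiteness of the measure of \<open>U n\<close> makes the extended difference zero.\<close>
    finally show ?thesis using eq Ufin[of n] by simp
  qed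
  have "AE x in M. \<forall>n. x \<notin> U n - S"
    unfolding AE_all_countable
  proof
    fix n
    have "U n - S \<in> null_sets M"
      using null Usets by (intro null_setsI) auto
    then show "AE x in M. x \<notin> U n - S" by (rule AE_not_in)
  qed
  then have ae: "AE x in M. ennreal (\<phi> x) = ennreal (\<phi> x) * indicator S x"
  proof eventually_elim
    case (elim x)
    show ?case
    proof (cases "0 < \<phi> x")
      case True
      then obtain n where "1 / real (Suc n) < \<phi> x"
        using nat_approx_posE by metis
      with elim show ?thesis by (auto simp: U_def)
    qed (auto simp: ennreal_neg)
  qed
  have "(\<integral>\<^sup>+x. ennreal (\<phi> x) \<partial>M) = (\<integral>\<^sup>+x. ennreal (\<phi> x) * indicator S x \<partial>M)"
    by (rule nn_integral_cong_AE[OF ae])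
  also have "\<dots> = (\<integral>\<^sup>+x. (SUP j. ennreal (\<phi> x) * indicator (D j) x) \<partial>M)"
  proof (intro nn_integral_cong)
    fix x
    have "indicator S x = (SUP j. indicator (D j) x :: ennreal)"
    proof (cases "x \<in> S")
      case True
      then obtain j where "x \<in> D j" by (auto simp: S_def)
      then have "(SUP j. indicator (D j) x :: ennreal) = 1"
        by (intro antisym SUP_least SUP_upper2[of j]) (auto simp: indicator_def)
      with True show ?thesis by simp
    qed (auto simp: S_def)
    then show "ennreal (\<phi> x) * indicator S x = (SUP j. ennreal (\<phi> x) * indicator (D j) x)"
      by (simp add: SUP_mult_left_ennreal)
  qed
  also have "\<dots> = (SUP j. \<integral>\<^sup>+x. ennreal (\<phi> x) * indicator (D j) x \<partial>M)"
  proof (rule nn_integral_monotone_convergence_SUP)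
    show "incseq (\<lambda>j x. ennreal (\<phi> x) * indicator (D j) x)"
      using incD by (auto simp: incseq_def le_fun_def indicator_def)
    show "(\<lambda>x. ennreal (\<phi> x) * indicator (D j) x) \<in> borel_measurable M" for j
      using csets[OF D[of j]] by measurable
  qed
  also have "\<dots> \<le> ennreal B"
    by (intro SUP_least compact D)
  finally show ?thesis .
qed

lemma norm_integral_le:
  fixes f :: "'a \<Rightarrow> 'b::{banach,second_countable_topology}"
  assumes "integrable M f" "integrable M g" "\<And>x. norm (f x) \<le> g x"
  shows "norm (LINT x|M. f x) \<le> (LINT x|M. g x)"
  by (rule order_trans[OF integral_norm_bound integral_mono[OF integrable_norm]])
    (use assms in auto)

lemma compact_continuous_bounded:
  fixes g :: "'a::topological_space \<Rightarrow> 'b::real_normed_vector"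
  assumes "compact K" "continuous_on UNIV g"
  obtains c where "\<And>x. x \<in> K \<Longrightarrow> norm (g x) \<le> c"
proof -
  have "bounded (g ` K)"
    by (intro compact_imp_bounded compact_continuous_image continuous_on_subset[OF assms(2)]
        assms(1)) simp
  then show ?thesis using that by (auto simp: bounded_iff)
qed

lemma integrable_mult_continuous:
  fixes w g :: "'a::t2_space \<Rightarrow> 'b::{real_normed_field,second_countable_topology,banach}"
  assumes M: "radon_measure M" and w: "integrable M w"
    and K: "compact K" "\<And>y. y \<notin> K \<Longrightarrow> w y = 0"
    and g: "continuous_on UNIV g"
  shows "integrable M (\<lambda>y. w y * g y)"
proof -
  obtain c where c: "\<And>x. x \<in> K \<Longrightarrow> norm (g x) \<le> c"
    using compact_continuous_bounded[OF K(1) g] by metis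
  show ?thesis
  proof (rule Bochner_Integration.integrable_bound)
    show "integrable M (\<lambda>y. c * norm (w y))"
      using w by simp
    show "(\<lambda>y. w y * g y) \<in> borel_measurable M"
      using borel_measurable_integrable[OF w] radon_measure_measurable[OF M g]
      by (rule borel_measurable_times)
    have "norm (w y * g y) \<le> norm (c * norm (w y))" for y
    proof (cases "y \<in> K")
      case True
      have "norm (w y * g y) \<le> norm (w y) * c"
        unfolding norm_mult by (intro mult_left_mono c True) simp
      also have "\<dots> \<le> norm (c * norm (w y))" by (simp add: mult.commute)
      finally show ?thesis .
    qed (simp add: K)
    then show "AE y in M. norm (w y * g y) \<le> norm (c * norm (w y))" by simp
  qed
qed

text \<open>
  By the tube lemma, \<open>G (y, x)\<close> tends to \<open>G (y, x0)\<close> uniformly for \<open>y\<close> in the compact set outside of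
  which the weight vanishes. This replaces dominated convergence, which would only yield sequential
  continuity in a space without countable bases of neighbourhoods.
\<close>
lemma continuous_compact_parameter_integral:
  fixes w :: "'a::t2_space \<Rightarrow> 'b::{real_normed_field,second_countable_topology,banach}"
    and G :: "'a \<times> 'c::topological_space \<Rightarrow> 'b"
  assumes M: "radon_measure M" and w: "integrable M w"
    and K: "compact K" "\<And>y. y \<notin> K \<Longrightarrow> w y = 0"
    and G: "continuous_on UNIV G"
  shows "continuous_on UNIV (\<lambda>x. LINT y|M. w y * G (y, x))"
proof -
  define W where "W = (LINT y|M. norm (w y))"
  have W0: "0 \<le> W" unfolding W_def by simp
  have contG: "continuous_on UNIV (\<lambda>y. G (y, x))" for x
    by (intro continuous_on_compose2[OF G] continuous_intros) auto
  have int: "integrable M (\<lambda>y. w y * G (y, x))" for x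
    by (rule integrable_mult_continuous[OF M w K(1) _ contG]) (rule K(2))
  have swap: "continuous_on (UNIV \<times> K) (\<lambda>(x, y). G (y, x))"
    unfolding case_prod_beta by (intro continuous_on_compose2[OF G] continuous_intros) auto
  have "((\<lambda>x. LINT y|M. w y * G (y, x)) \<longlongrightarrow> (LINT y|M. w y * G (y, x0))) (at x0)" for x0
  proof (rule tendstoI)
    fix \<epsilon> :: real assume "0 < \<epsilon>"
    \<comment> \<open>The summand 1 covers the case that the weight is null.\<close>
    define \<delta> where "\<delta> = \<epsilon> / (W + 1)"
    have \<delta>: "0 < \<delta>" using \<open>0 < \<epsilon>\<close> W0 by (simp add: \<delta>_def)
    obtain X where X: "x0 \<in> X" "open X"
      and near: "\<forall>x\<in>X \<inter> UNIV. \<forall>y\<in>K.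
          dist ((\<lambda>(x, y). G (y, x)) (x, y)) ((\<lambda>(x, y). G (y, x)) (x0, y)) \<le> \<delta>"
      using continuous_on_prod_compactE[OF swap K(1) UNIV_I \<delta>] by blast
    have "dist (LINT y|M. w y * G (y, x)) (LINT y|M. w y * G (y, x0)) < \<epsilon>" if "x \<in> X" for x
    proof -
      have pt: "norm (w y * G (y, x) - w y * G (y, x0)) \<le> \<delta> * norm (w y)" for y
      proof (cases "y \<in> K")
        case True
        then have "norm (G (y, x) - G (y, x0)) \<le> \<delta>"
          using near that by (auto simp: dist_norm)
        then show ?thesis
          by (simp add: right_diff_distrib[symmetric] norm_mult mult.commute[of \<delta>] mult_left_mono)
      qed (simp add: K)
      have "dist (LINT y|M. w y * G (y, x)) (LINT y|M. w y * G (y, x0))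
          = norm (LINT y|M. w y * G (y, x) - w y * G (y, x0))"
        by (simp add: dist_norm int)
      also have "\<dots> \<le> (LINT y|M. \<delta> * norm (w y))"
        using pt w by (intro norm_integral_le Bochner_Integration.integrable_diff int) auto
      also have "\<dots> = \<delta> * W" by (simp add: W_def)
      also have "\<dots> < \<delta> * (W + 1)" using \<delta> by simp
      also have "\<dots> = \<epsilon>" using W0 by (simp add: \<delta>_def)
      finally show ?thesis .
    qed
    then show "\<forall>\<^sub>F x in at x0.
        dist (LINT y|M. w y * G (y, x)) (LINT y|M. w y * G (y, x0)) < \<epsilon>"
      using X by (auto simp: eventually_at_topological)
  qed
  then show ?thesis by (auto simp: continuous_on_def)
qed

text \<open>
  One inequality of Tonelli's theorem for a kernel that is merely continuous, without
  \<open>\<sigma>\<close>-finiteness and without measurability for the product \<open>\<sigma>\<close>-algebra. For \<open>x\<close> in a compact set \<open>C\<close>,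
  a finite partition of \<open>K\<close> into Borel sets \<open>E i\<close> around points \<open>d i\<close> replaces \<open>G (y, x)\<close> by \<open>G (d i, x)\<close> up
  to \<open>\<epsilon>\<close>. Integration over \<open>C\<close> then only involves finitely many slices of \<open>G\<close>, and the error is
  proportional to \<open>\<epsilon>\<close> times the measure of \<open>C\<close>.
\<close>
lemma nn_integral_compact_parameter_integral_le:
  fixes M :: "'a::t2_space measure" and w :: "'a \<Rightarrow> real" and G :: "'a \<times> 'a \<Rightarrow> real"
  assumes M: "radon_measure M" and w: "integrable M w" and w0: "\<And>y. 0 \<le> w y"
    and K: "compact K" "\<And>y. y \<notin> K \<Longrightarrow> w y = 0"
    and G: "continuous_on UNIV G" and G0: "\<And>p. 0 \<le> G p"
    and B0: "0 \<le> B" and B: "\<And>y. (\<integral>\<^sup>+x. ennreal (G (y, x)) \<partial>M) \<le> ennreal B"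
  shows "(\<integral>\<^sup>+x. ennreal (LINT y|M. w y * G (y, x)) \<partial>M) \<le> ennreal ((LINT y|M. w y) * B)"
proof (rule radon_nn_integral_le_if_compact[OF M])
  show "continuous_on UNIV (\<lambda>x. LINT y|M. w y * G (y, x))"
    by (rule continuous_compact_parameter_integral[OF M w K(1) _ G]) (rule K(2))
  fix C :: "'a set" assume C: "compact C"
  define W where "W = (LINT y|M. w y)"
  have W0: "0 \<le> W" unfolding W_def using w0 by simp
  have Csets [measurable]: "C \<in> sets M" by (rule radon_measure_compact_sets[OF M C])
  define c where "c = measure M C"
  have c: "emeasure M C = ennreal c" "0 \<le> c"
    using radon_measure_compact_finite[OF M C] by (auto simp: c_def emeasure_eq_ennreal_measure)
  have contG: "continuous_on UNIV (\<lambda>y. G (y, x))" for x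
    by (intro continuous_on_compose2[OF G] continuous_intros) auto
  have contG': "continuous_on UNIV (\<lambda>x. G (y, x))" for y
    by (intro continuous_on_compose2[OF G] continuous_intros) auto
  note [measurable] = radon_measure_measurable[OF M contG']
  note [measurable] = borel_measurable_integrable[OF w]
  have int: "integrable M (\<lambda>y. w y * G (y, x))" for x
    by (rule integrable_mult_continuous[OF M w K(1) _ contG]) (rule K(2))
  have approx: "(\<integral>\<^sup>+x\<in>C. ennreal (LINT y|M. w y * G (y, x)) \<partial>M) \<le> ennreal (W * (B + \<epsilon> * c))"
    if \<epsilon>: "0 < \<epsilon>" for \<epsilon>
  proof -
    have "\<exists>V. y \<in> V \<and> open V \<and> (\<forall>y'\<in>V. \<forall>x\<in>C. dist (G (y', x)) (G (y, x)) \<le> \<epsilon>)" for y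
      using continuous_on_prod_compactE[of UNIV C G y \<epsilon>] C \<epsilon> continuous_on_subset[OF G]
      by (metis IntI UNIV_I subset_UNIV)
    then obtain V where V: "\<And>y. y \<in> V y" "\<And>y. open (V y)"
      and near: "\<And>y y' x. y' \<in> V y \<Longrightarrow> x \<in> C \<Longrightarrow> dist (G (y', x)) (G (y, x)) \<le> \<epsilon>"
      by metis
    obtain D where D: "D \<subseteq> K" "finite D" "K \<subseteq> (\<Union>y\<in>D. V y)"
      using compactE_image[OF K(1), of K V] V by blast
    obtain n :: nat and d where d: "D = d ` {i. i < n}"
      using D(2) finite_imp_nat_seg_image_inj_on by metis
    \<comment> \<open>Cutting the covering open sets into disjoint pieces turns them into the partition.\<close>
    define E where "E i = disjointed (\<lambda>j. V (d j)) i" for i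
    have E [measurable]: "E i \<in> sets M" for i
    proof -
      have "E i \<in> sets borel"
        unfolding E_def disjointed_def using V(2) by (intro sets.Diff sets.finite_UN) auto
      then show ?thesis using radon_measure_sets[OF M] by simp
    qed
    have EV: "E i \<subseteq> V (d i)" for i
      unfolding E_def by (rule disjointed_subset)
    have cover: "\<exists>i<n. y \<in> E i" if "y \<in> K" for y
    proof -
      have "{i. i < n} = {0..<n}" by auto
      with that D(3) d have "y \<in> (\<Union>i\<in>{0..<n}. V (d i))" by auto
      then have "y \<in> (\<Union>i\<in>{0..<n}. E i)"
        unfolding E_def finite_UN_disjointed_eq .
      then show ?thesis by auto
    qed
    have one: "w y = (\<Sum>i<n. w y * indicator (E i) y)" for y
    proof (cases "y \<in> K")
      case True
      then obtain i where i: "i < n" "y \<in> E i" using cover by blast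
      have "y \<notin> E j" if "j \<noteq> i" for j
        using disjoint_family_disjointed[of "\<lambda>j. V (d j)"] i that
        by (auto simp: disjoint_family_on_def E_def)
      then have "(\<Sum>j<n. w y * indicator (E j) y) = (\<Sum>j<n. if j = i then w y else 0)"
        using i by (intro sum.cong) auto
      then show ?thesis using i by simp
    qed (simp add: K)
    define a where "a i = (LINT y|M. w y * indicator (E i) y)" for i
    have inta: "integrable M (\<lambda>y. w y * indicator (E i) y)" for i
      by (intro integrable_mult_indicator[OF E w, unfolded real_scaleR_def mult.commute[of "indicator _ _"]])
    have a0: "0 \<le> a i" for i unfolding a_def using w0 by simp
    have suma: "(\<Sum>i<n. a i) = W"
      unfolding a_def W_def
      by (subst Bochner_Integration.integral_sum[OF inta, symmetric]) (simp only: one[symmetric])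
    have bound: "(LINT y|M. w y * G (y, x)) \<le> (\<Sum>i<n. a i * (G (d i, x) + \<epsilon>))" if "x \<in> C" for x
    proof -
      have "(LINT y|M. w y * G (y, x))
          \<le> (LINT y|M. (\<Sum>i<n. w y * indicator (E i) y * (G (d i, x) + \<epsilon>)))"
      proof (intro integral_mono int Bochner_Integration.integrable_sum
          Bochner_Integration.integrable_mult_left inta)
        fix y
        have "w y * G (y, x) = (\<Sum>i<n. w y * indicator (E i) y * G (y, x))"
          using arg_cong[OF one[of y], of "\<lambda>v. v * G (y, x)"] by (simp only: sum_distrib_right)
        also have "\<dots> \<le> (\<Sum>i<n. w y * indicator (E i) y * (G (d i, x) + \<epsilon>))"
        proof (intro sum_mono)
          fix i
          show "w y * indicator (E i) y * G (y, x)
              \<le> w y * indicator (E i) y * (G (d i, x) + \<epsilon>)"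
          proof (cases "y \<in> E i")
            case True
            then have "dist (G (y, x)) (G (d i, x)) \<le> \<epsilon>"
              using near EV \<open>x \<in> C\<close> by blast
            then show ?thesis
              using w0[of y] by (auto simp: dist_real_def intro!: mult_left_mono)
          qed simp
        qed
        finally show "w y * G (y, x) \<le> (\<Sum>i<n. w y * indicator (E i) y * (G (d i, x) + \<epsilon>))" .
      qed
      also have "\<dots> = (\<Sum>i<n. a i * (G (d i, x) + \<epsilon>))"
        unfolding a_def using inta by (subst Bochner_Integration.integral_sum) auto
      finally show ?thesis .
    qed
    \<comment> \<open>The indicator of \<open>C\<close> is kept on the error term only: the slices of \<open>G\<close> are integrated over
      the whole space, where their integrals are bounded by assumption.\<close>
    have "(\<integral>\<^sup>+x\<in>C. ennreal (LINT y|M. w y * G (y, x)) \<partial>M)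
        \<le> (\<integral>\<^sup>+x. (\<Sum>i<n. ennreal (a i) * (ennreal (G (d i, x)) + ennreal \<epsilon> * indicator C x)) \<partial>M)"
    proof (intro nn_integral_mono)
      fix x
      show "ennreal (LINT y|M. w y * G (y, x)) * indicator C x
          \<le> (\<Sum>i<n. ennreal (a i) * (ennreal (G (d i, x)) + ennreal \<epsilon> * indicator C x))"
      proof (cases "x \<in> C")
        case True
        have "ennreal (LINT y|M. w y * G (y, x)) \<le> ennreal (\<Sum>i<n. a i * (G (d i, x) + \<epsilon>))"
          by (intro ennreal_leI bound True)
        also have "\<dots> = (\<Sum>i<n. ennreal (a i) * (ennreal (G (d i, x)) + ennreal \<epsilon>))"
          using a0 G0 \<epsilon> by (subst sum_ennreal[symmetric]) (auto simp: ennreal_mult)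
        finally show ?thesis using True by simp
      qed simp
    qed
    also have "\<dots> = (\<Sum>i<n. ennreal (a i)
        * ((\<integral>\<^sup>+x. ennreal (G (d i, x)) \<partial>M) + ennreal \<epsilon> * ennreal c))"
      by (subst nn_integral_sum)
         (auto simp: nn_integral_cmult nn_integral_add nn_integral_cmult_indicator c(1))
    also have "\<dots> \<le> (\<Sum>i<n. ennreal (a i) * (ennreal B + ennreal \<epsilon> * ennreal c))"
      by (intro sum_mono mult_left_mono add_mono B order_refl) auto
    also have "\<dots> = (\<Sum>i<n. ennreal (a i * (B + \<epsilon> * c)))"
      using a0 B0 c(2) \<epsilon> by (simp add: ennreal_mult)
    also have "\<dots> = ennreal (\<Sum>i<n. a i * (B + \<epsilon> * c))"
      using a0 B0 c(2) \<epsilon> by (intro sum_ennreal) simp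
    also have "(\<Sum>i<n. a i * (B + \<epsilon> * c)) = W * (B + \<epsilon> * c)"
      by (simp add: suma sum_distrib_right[symmetric])
    finally show ?thesis .
  qed
  show "(\<integral>\<^sup>+x\<in>C. ennreal (LINT y|M. w y * G (y, x)) \<partial>M) \<le> ennreal ((LINT y|M. w y) * B)"
    unfolding W_def[symmetric]
  proof (rule ennreal_le_epsilon)
    fix \<eta> :: real assume \<eta>: "0 < \<eta>"
    define \<epsilon> where "\<epsilon> = \<eta> / (W * c + 1)"
    have pos: "0 < W * c + 1" using W0 c(2) by (simp add: add_nonneg_pos)
    have \<epsilon>: "0 < \<epsilon>" using \<eta> pos by (simp add: \<epsilon>_def)
    have "\<epsilon> * (W * c) \<le> \<epsilon> * (W * c + 1)" using \<epsilon> by simp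
    also have "\<dots> = \<eta>" using pos by (simp add: \<epsilon>_def)
    finally have "W * (B + \<epsilon> * c) \<le> W * B + \<eta>" by (simp add: algebra_simps)
    then have "ennreal (W * (B + \<epsilon> * c)) \<le> ennreal (W * B + \<eta>)" by (rule ennreal_leI)
    also have "\<dots> = ennreal (W * B) + ennreal \<eta>"
      using W0 B0 \<eta> by (intro ennreal_plus) auto
    finally have "ennreal (W * (B + \<epsilon> * c)) \<le> ennreal (W * B) + ennreal \<eta>" .
    with approx[OF \<epsilon>] show "(\<integral>\<^sup>+x\<in>C. ennreal (LINT y|M. w y * G (y, x)) \<partial>M)
        \<le> ennreal (W * B) + ennreal \<eta>"
      by (rule order_trans)
  qed
qed

section \<open>Compactly supported continuous functions\<close>

lemma CcE:
  assumes "f \<in> Cc"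
  obtains K where "compact K" "\<And>x. x \<notin> K \<Longrightarrow> f x = 0" "continuous_on UNIV f"
  using assms closure_subset[of "{x. f x \<noteq> 0}"] that unfolding Cc_def by blast

lemma CcI:
  fixes f :: "'a::t2_space \<Rightarrow> complex"
  assumes "continuous_on UNIV f" "compact K" "\<And>x. x \<notin> K \<Longrightarrow> f x = 0"
  shows "f \<in> Cc"
proof -
  have "closure {x. f x \<noteq> 0} \<subseteq> K"
    using assms(2,3) by (intro closure_minimal compact_imp_closed) auto
  then have "compact (closure {x. f x \<noteq> 0})"
    using assms(2) by (metis closed_closure compact_Int_closed inf.absorb_iff2)
  with assms(1) show ?thesis by (simp add: Cc_def)
qed

lemma Cc_bounded:
  assumes "f \<in> Cc"
  obtains c where "\<And>x. cmod (f x) \<le> c"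
proof -
  obtain K where K: "compact K" "\<And>x. x \<notin> K \<Longrightarrow> f x = 0" "continuous_on UNIV f"
    using CcE[OF assms] by metis
  obtain c where c: "\<And>x. x \<in> K \<Longrightarrow> norm (f x) \<le> c"
    using compact_continuous_bounded[OF K(1,3)] by metis
  have "cmod (f x) \<le> max c 0" for x
    using c[of x] K(2)[of x] by (cases "x \<in> K") auto
  then show ?thesis using that by blast
qed

lemma Cc_sum_of_moduli:
  fixes f g :: "'a::t2_space \<Rightarrow> complex"
  assumes "f \<in> Cc" "g \<in> Cc"
  shows "(\<lambda>x. complex_of_real (cmod (f x) + cmod (g x))) \<in> Cc"
proof -
  obtain K where K: "compact K" "\<And>x. x \<notin> K \<Longrightarrow> f x = 0" "continuous_on UNIV f"
    using CcE[OF assms(1)] by metis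
  obtain L where L: "compact L" "\<And>x. x \<notin> L \<Longrightarrow> g x = 0" "continuous_on UNIV g"
    using CcE[OF assms(2)] by metis
  show ?thesis
  proof (rule CcI)
    show "continuous_on UNIV (\<lambda>x. complex_of_real (cmod (f x) + cmod (g x)))"
      by (intro continuous_intros K L)
    show "compact (K \<union> L)" using K L by blast
  qed (use K L in auto)
qed

text \<open>
  A function supported in \<open>K\<close> is its own product with the indicator of \<open>K\<close>, which is integrable because
  \<open>K\<close> has finite measure.
\<close>
lemma radon_measure_Cc_integrable:
  fixes f :: "'a::t2_space \<Rightarrow> complex"
  assumes M: "radon_measure M" and f: "f \<in> Cc"
  shows "integrable M f"
proof -
  obtain K where K: "compact K" "\<And>x. x \<notin> K \<Longrightarrow> f x = 0" "continuous_on UNIV f"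
    using CcE[OF f] by metis
  have "integrable M (\<lambda>x. complex_of_real (indicator K x))"
    using radon_measure_compact_sets[OF M K(1)] radon_measure_compact_finite[OF M K(1)]
    by (intro integrable_of_real integrable_real_indicator)
  then have "integrable M (indicator K :: 'a \<Rightarrow> complex)"
    by (simp add: of_real_indicator)
  then have "integrable M (\<lambda>y. indicator K y * f y)"
    by (rule integrable_mult_continuous[OF M _ K(1) _ K(3)]) auto
  also have "(\<lambda>y. indicator K y * f y) = f"
    using K(2) by (auto simp: fun_eq_iff indicator_def)
  finally show ?thesis .
qed

section \<open>Translates in a hypergroup\<close>

lemma pos_measure_dirac: "pos_measure (dirac x) = return borel x"
proof -
  have "pos_measure (dirac x)
      = measure_of (space (return borel x)) (sets (return borel x)) (emeasure (return borel x))"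
    unfolding pos_measure_def dirac_def space_return sets_return space_borel
    by (intro measure_of_eq)
       (auto simp: sets.sigma_sets_eq[of borel, simplified] measure_def indicator_def)
  then show ?thesis by (simp only: measure_of_of_measure)
qed

lemma sets_pos_measure: "sets (pos_measure \<mu>) = sets borel"
  unfolding pos_measure_def
  by (metis sets.sets_measure_of_eq space_borel)

lemma Cc_measurable_pos_measure:
  assumes "f \<in> Cc"
  shows "f \<in> borel_measurable (pos_measure \<mu>)"
proof -
  have "continuous_on UNIV f" using assms by (simp add: Cc_def)
  then show ?thesis
    using borel_measurable_continuous_onI sets_pos_measure[of \<mu>]
    by (simp cong: measurable_cong_sets)
qed

lemma continuous_map_weak_topology_integral:
  assumes "f \<in> Cc"
  shows "continuous_map weak_topology euclidean (\<lambda>\<mu>. LINT t|pos_measure \<mu>. f t)"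
proof -
  have top: "topspace weak_topology \<subseteq> nonneg_radon_measures"
    unfolding weak_topology_def topology_generated_by_topspace by auto
  have "openin weak_topology {\<mu> \<in> nonneg_radon_measures. (LINT t|pos_measure \<mu>. f t) \<in> U}"
    if "open U" for U
    unfolding weak_topology_def using assms that by (intro topology_generated_by_Basis) blast
  moreover have "{\<mu> \<in> topspace weak_topology. (LINT t|pos_measure \<mu>. f t) \<in> U}
      = topspace weak_topology \<inter> {\<mu> \<in> nonneg_radon_measures. (LINT t|pos_measure \<mu>. f t) \<in> U}" for U
    using top by auto
  ultimately show ?thesis by (auto simp: continuous_map intro: openin_Int)
qed

text \<open>
  Every unit mass is itself a convolution of two unit masses, one of them at the identity.
\<close>
lemma (in hypergroup) dirac_nonneg_radon: "dirac (x :: 'a) \<in> nonneg_radon_measures"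
  using conv_dirac_nonneg[of e x] by (simp add: conv_id_left)

lemma (in hypergroup) continuous_map_dirac:
  "continuous_map euclidean weak_topology (dirac :: 'a \<Rightarrow> _)"
  unfolding weak_topology_def
proof (rule continuous_on_generated_topo)
  fix W :: "('a set \<Rightarrow> complex) set"
  assume "W \<in> {{\<mu> \<in> nonneg_radon_measures. (LINT t|pos_measure \<mu>. f t) \<in> U} |f U.
      f \<in> Cc \<union> {\<lambda>_. 1} \<and> open U}"
  then obtain f :: "'a \<Rightarrow> complex" and U
    where W: "W = {\<mu> \<in> nonneg_radon_measures. (LINT t|pos_measure \<mu>. f t) \<in> U}"
      and f: "f \<in> Cc \<union> {\<lambda>_. 1}" and U: "open U"
    by blast
  have cont: "continuous_on UNIV f" using f by (auto simp: Cc_def)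
  have "(LINT t|pos_measure (dirac x). f t) = f x" for x
    unfolding pos_measure_dirac
    using borel_measurable_continuous_onI[OF cont] by (intro integral_return) auto
  then have "dirac -` W = f -` U"
    unfolding W using dirac_nonneg_radon by auto
  then show "openin euclidean (dirac -` W \<inter> topspace euclidean)"
    using open_vimage[OF U cont] by simp
next
  show "(dirac :: 'a \<Rightarrow> _) ` topspace euclidean
      \<subseteq> \<Union> {{\<mu> \<in> nonneg_radon_measures. (LINT t|pos_measure \<mu>. f t) \<in> U} |f U.
      f \<in> Cc \<union> {\<lambda>_. 1} \<and> open U}"
  proof (rule image_subsetI)
    fix x :: 'a
    show "dirac x \<in> \<Union> {{\<mu> \<in> nonneg_radon_measures. (LINT t|pos_measure \<mu>. f t) \<in> U} |f U.
        f \<in> Cc \<union> {\<lambda>_. 1} \<and> open U}"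
      by (rule UnionI[where X = "{\<mu> \<in> nonneg_radon_measures.
            (LINT t|pos_measure \<mu>. (\<lambda>_. 1 :: complex) t) \<in> UNIV}"])
         (use dirac_nonneg_radon in blast)+
  qed
qed

text \<open>
  The value \<open>f(xy)\<close> is the composition of three continuous maps: unit masses at \<open>x\<close> and \<open>y\<close>, convolution
  of measures, and integration of \<open>f\<close>.
\<close>
lemma (in hypergroup) continuous_product_eval:
  assumes "f \<in> Cc"
  shows "continuous_on UNIV (\<lambda>p. product_eval f (fst p) (snd p))"
proof -
  have "continuous_map (prod_topology euclidean euclidean)
      (prod_topology weak_topology weak_topology) (\<lambda>(x::'a, y::'a). (dirac x, dirac y))"
    using continuous_map_dirac by (intro continuous_map_prod_top[THEN iffD2]) auto
  then have "continuous_map (prod_topology euclidean euclidean) euclidean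
      ((\<lambda>\<mu>. LINT t|pos_measure \<mu>. f t) \<circ> ((\<lambda>(\<mu>, \<nu>). conv \<mu> \<nu>) \<circ> (\<lambda>(x, y). (dirac x, dirac y))))"
    by (intro continuous_map_compose[OF _ continuous_map_weak_topology_integral[OF assms]]
        continuous_map_compose[OF _ conv_continuous])
  then have "continuous_on UNIV
      ((\<lambda>\<mu>. LINT t|pos_measure \<mu>. f t) \<circ> ((\<lambda>(\<mu>, \<nu>). conv \<mu> \<nu>) \<circ> (\<lambda>(x, y). (dirac x, dirac y))))"
    by simp
  also have "((\<lambda>\<mu>. LINT t|pos_measure \<mu>. f t) \<circ> ((\<lambda>(\<mu>, \<nu>). conv \<mu> \<nu>) \<circ> (\<lambda>(x, y). (dirac x, dirac y))))
      = (\<lambda>p. product_eval f (fst p) (snd p))"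
    by (auto simp: product_eval_def)
  finally show ?thesis .
qed

lemma (in hypergroup) Cc_integrable_product:
  assumes "f \<in> Cc"
  shows "integrable (pos_measure (conv (dirac x) (dirac y))) f"
proof -
  interpret prob_space "pos_measure (conv (dirac x) (dirac y))" by (rule conv_dirac_prob)
  obtain c where "\<And>x. cmod (f x) \<le> c" using Cc_bounded[OF assms] by metis
  then show ?thesis
    by (intro integrable_const_bound[of _ c] Cc_measurable_pos_measure assms) auto
qed

lemma (in hypergroup) norm_product_eval_le:
  fixes k :: "'a \<Rightarrow> real"
  assumes f: "f \<in> Cc" and k: "(\<lambda>x. complex_of_real (k x)) \<in> Cc" and le: "\<And>x. cmod (f x) \<le> k x"
  shows "cmod (product_eval f x y) \<le> Re (product_eval (\<lambda>x. complex_of_real (k x)) x y)"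
  using Cc_integrable_product[OF f] integrable_Re[OF Cc_integrable_product[OF k]] le
  by (auto simp: product_eval_def intro!: norm_integral_le)

lemma (in hypergroup) continuous_invol: "continuous_on UNIV invol"
  and invol_invol: "invol (invol x) = x"
  using invol_homeomorphic by (auto simp: homeomorphism_def)

lemma (in hypergroup) tilde_Cc:
  assumes "f \<in> Cc"
  shows "tilde f \<in> Cc"
proof -
  obtain K where K: "compact K" "\<And>x. x \<notin> K \<Longrightarrow> f x = 0" "continuous_on UNIV f"
    using CcE[OF assms] by metis
  show ?thesis
  proof (rule CcI)
    show "continuous_on UNIV (tilde f)"
      unfolding tilde_def
      by (intro continuous_intros continuous_on_compose2[OF K(3) continuous_invol]) auto
    show "compact (invol ` K)"
      by (intro compact_continuous_image continuous_on_subset[OF continuous_invol] K) auto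
    show "tilde f x = 0" if "x \<notin> invol ` K" for x
    proof -
      have "invol x \<notin> K" using that invol_invol by (metis imageI)
      then show ?thesis by (simp add: tilde_def K)
    qed
  qed
qed

section \<open>Convolutions of test functions\<close>

text \<open>
  Left invariance is an equation between Bochner integrals, which are 0 for functions that are not
  integrable. A nonzero value on the right therefore forces the translate to be integrable; this is
  what the hypothesis of a nonzero integral is for.
\<close>
lemma (in haar_hypergroup) nn_integral_translate:
  fixes k :: "'a \<Rightarrow> real"
  assumes k: "(\<lambda>x. complex_of_real (k x)) \<in> Cc" and k0: "\<And>x. 0 \<le> k x"
    and ne: "(LINT x|haar. k x) \<noteq> 0"
  shows "(\<integral>\<^sup>+y. ennreal (Re (product_eval (\<lambda>x. complex_of_real (k x)) x y)) \<partial>haar)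
      = ennreal (LINT x|haar. k x)"
proof -
  let ?p = "product_eval (\<lambda>x. complex_of_real (k x)) x"
  have eq: "(LINT y|haar. ?p y) = complex_of_real (LINT x|haar. k x)"
    using haar_left_invariant[OF k] by simp
  then have int: "integrable haar ?p"
    using ne not_integrable_integral_eq by fastforce
  have "0 \<le> Re (?p y)" for y
    by (simp add: product_eval_def k0)
  then have "(\<integral>\<^sup>+y. ennreal (Re (?p y)) \<partial>haar) = ennreal (LINT y|haar. Re (?p y))"
    using int by (intro nn_integral_eq_integral) auto
  also have "(LINT y|haar. Re (?p y)) = Re (LINT y|haar. ?p y)"
    using int by simp
  finally show ?thesis by (simp add: eq)
qed

lemma (in hypergroup) continuous_left_translates:
  assumes "f \<in> Cc"
  shows "continuous_on UNIV (\<lambda>p. product_eval f (invol (fst p)) (snd p))"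
proof -
  have "continuous_on UNIV (\<lambda>p :: 'a \<times> 'a. (invol (fst p), snd p))"
    by (intro continuous_intros continuous_on_compose2[OF continuous_invol]) auto
  from continuous_on_compose2[OF continuous_product_eval[OF assms] this]
  show ?thesis by simp
qed

lemma (in haar_hypergroup) fun_conv_integrand:
  assumes f: "f \<in> Cc" and g: "g \<in> Cc"
  shows "integrable haar (\<lambda>y. f y * product_eval g (invol y) x)"
proof -
  obtain K where K: "compact K" "\<And>x. x \<notin> K \<Longrightarrow> f x = 0" using CcE[OF f] by metis
  have "continuous_on UNIV (\<lambda>y::'a. (y, x))" by (intro continuous_intros)
  from continuous_on_compose2[OF continuous_left_translates[OF g] this]
  have "continuous_on UNIV (\<lambda>y. product_eval g (invol y) x)" by simp
  with K show ?thesis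
    by (intro integrable_mult_continuous[OF haar_radon radon_measure_Cc_integrable[OF haar_radon f]])
qed

lemma (in haar_hypergroup) fun_conv_continuous:
  assumes f: "f \<in> Cc" and g: "g \<in> Cc"
  shows "continuous_on UNIV (fun_conv f g)"
proof -
  obtain K where K: "compact K" "\<And>x. x \<notin> K \<Longrightarrow> f x = 0"
    using CcE[OF f] by metis
  have "continuous_on UNIV
      (\<lambda>x. LINT y|haar. f y * (\<lambda>p. product_eval g (invol (fst p)) (snd p)) (y, x))"
    using K by (intro continuous_compact_parameter_integral[OF haar_radon
        radon_measure_Cc_integrable[OF haar_radon f]] continuous_left_translates[OF g])
  then show ?thesis by (simp add: fun_conv_def)
qed

text \<open>
  The dominating function is \<open>\<phi>(x) = \<integral> |f(y)| k(invol(y) x) dy\<close> with \<open>k = |f| + |g|\<close>. Using \<open>k\<close> rather than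
  \<open>|g|\<close> guarantees a nonzero integral as soon as \<open>f\<close> is not null, so that left invariance yields
  integrable translates; and for null \<open>f\<close> the convolution is identically 0.
\<close>
lemma (in haar_hypergroup) fun_conv_integrable:
  assumes f: "f \<in> Cc" and g: "g \<in> Cc"
  shows "integrable haar (fun_conv f g)"
proof (cases "(LINT y|haar. cmod (f y)) = 0")
  case True
  have "AE y in haar. cmod (f y) = 0"
    using True radon_measure_Cc_integrable[OF haar_radon f]
    by (subst (asm) integral_nonneg_eq_0_iff_AE) auto
  then have "fun_conv f g x = (LINT y|haar. 0)" for x
    unfolding fun_conv_def
  proof (intro integral_cong_AE)
    assume ae: "AE y in haar. cmod (f y) = 0"
    show "AE y in haar. f y * product_eval g (invol y) x = 0"
      using ae by eventually_elim simp
    show "(\<lambda>y. f y * product_eval g (invol y) x) \<in> borel_measurable haar"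
      by (rule borel_measurable_integrable[OF fun_conv_integrand[OF f g]])
  qed simp
  then have "fun_conv f g = (\<lambda>x. 0)" by auto
  then show ?thesis by simp
next
  case False
  define k where "k x = cmod (f x) + cmod (g x)" for x
  define G where "G = (\<lambda>p. Re (product_eval (\<lambda>x. complex_of_real (k x)) (invol (fst p)) (snd p)))"
  have kCc: "(\<lambda>x. complex_of_real (k x)) \<in> Cc"
    unfolding k_def by (rule Cc_sum_of_moduli[OF f g])
  note intf = radon_measure_Cc_integrable[OF haar_radon f]
  note intg = radon_measure_Cc_integrable[OF haar_radon g]
  have k0: "0 \<le> k x" for x by (simp add: k_def)
  have "(LINT y|haar. k y) = (LINT y|haar. cmod (f y)) + (LINT y|haar. cmod (g y))"
    unfolding k_def using intf intg by simp
  moreover have "0 \<le> (LINT y|haar. cmod (f y))" "0 \<le> (LINT y|haar. cmod (g y))" by simp_all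
  ultimately have kne: "(LINT y|haar. k y) \<noteq> 0" using False by linarith
  have G0: "0 \<le> G p" for p by (simp add: G_def product_eval_def k0)
  have contG: "continuous_on UNIV G"
    unfolding G_def by (intro continuous_intros continuous_left_translates kCc)
  have contG': "continuous_on UNIV (\<lambda>y. G (y, x))" for x
    by (intro continuous_on_compose2[OF contG] continuous_intros) auto
  obtain K where K: "compact K" "\<And>x. x \<notin> K \<Longrightarrow> f x = 0" using CcE[OF f] by metis
  have intn: "integrable haar (\<lambda>y. cmod (f y))" using intf by simp
  have nK: "cmod (f y) = 0" if "y \<notin> K" for y using K(2)[OF that] by simp
  define \<phi> where "\<phi> x = (LINT y|haar. cmod (f y) * G (y, x))" for x
  have \<phi>0: "0 \<le> \<phi> x" for x unfolding \<phi>_def by (simp add: G0)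
  have bound: "(\<integral>\<^sup>+x. ennreal (G (y, x)) \<partial>haar) \<le> ennreal (LINT x|haar. k x)" for y
    unfolding G_def using nn_integral_translate[OF kCc k0 kne] by simp
  have "(\<integral>\<^sup>+x. ennreal (\<phi> x) \<partial>haar)
      \<le> ennreal ((LINT y|haar. cmod (f y)) * (LINT x|haar. k x))"
    unfolding \<phi>_def
    by (rule nn_integral_compact_parameter_integral_le[OF haar_radon intn norm_ge_zero K(1) nK
          contG G0 _ bound]) (simp_all add: k0)
  then have fin: "(\<integral>\<^sup>+x. ennreal (\<phi> x) \<partial>haar) < \<infinity>"
    by (rule le_less_trans) simp
  have "continuous_on UNIV \<phi>"
    unfolding \<phi>_def
    by (rule continuous_compact_parameter_integral[OF haar_radon intn K(1) nK contG])
  then have "\<phi> \<in> borel_measurable haar" by (rule radon_measure_measurable[OF haar_radon])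
  then have int\<phi>: "integrable haar \<phi>" using fin \<phi>0 by (intro integrableI_nonneg) auto
  have "cmod (fun_conv f g x) \<le> \<phi> x" for x
    unfolding fun_conv_def \<phi>_def
  proof (rule norm_integral_le)
    show "integrable haar (\<lambda>y. f y * product_eval g (invol y) x)"
      by (rule fun_conv_integrand[OF f g])
    show "integrable haar (\<lambda>y. cmod (f y) * G (y, x))"
      by (rule integrable_mult_continuous[OF haar_radon intn K(1) nK contG'])
    fix y
    have "cmod (product_eval g (invol y) x) \<le> G (y, x)"
      unfolding G_def fst_conv snd_conv
      by (intro norm_product_eval_le g kCc) (simp add: k_def)
    then show "cmod (f y * product_eval g (invol y) x) \<le> cmod (f y) * G (y, x)"
      by (simp add: norm_mult mult_left_mono)
  qed
  then show ?thesis
    using \<phi>0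
    by (intro Bochner_Integration.integrable_bound[OF int\<phi>]
        radon_measure_measurable[OF haar_radon fun_conv_continuous[OF f g]]) auto
qed

section \<open>The Lebesgue-Fourier algebra\<close>

lemma (in haar_hypergroup) fourier_span_continuous_integrable:
  assumes "v \<in> fourier_span"
  shows "continuous_on UNIV v" "v \<in> L1"
proof -
  obtain n :: nat and c f where v: "v = (\<lambda>x. \<Sum>i<n. c i * fun_conv (f i) (tilde (f i)) x)"
    and f: "\<And>i. i < n \<Longrightarrow> f i \<in> Cc"
    using assms unfolding fourier_span_def by blast
  show "continuous_on UNIV v"
    unfolding v by (intro continuous_intros fun_conv_continuous f tilde_Cc) auto
  show "v \<in> L1"
    unfolding v L1_def mem_Collect_eq
    by (intro Bochner_Integration.integrable_sum Bochner_Integration.integrable_mult_right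
        fun_conv_integrable f tilde_Cc) auto
qed

lemma (in haar_hypergroup) L1_function_subspace: "function_subspace L1"
  unfolding function_subspace_def L1_def
  by (intro conjI ballI allI CollectI integrable_zero Bochner_Integration.integrable_add
      Bochner_Integration.integrable_mult_right) (simp_all only: mem_Collect_eq)

lemma (in haar_hypergroup) B_lambda_mult_L1:
  assumes "u \<in> B_lambda" "v \<in> L1"
  shows "(\<lambda>x. u x * v x) \<in> L1"
proof -
  obtain \<Phi> where "realizes u \<Phi>" using assms(1) unfolding B_lambda_def by blast
  then have "integrable haar (\<lambda>x. u x * v x)"
    using assms(2) unfolding realizes_def by blast
  then show ?thesis by (simp add: L1_def)
qed

lemma (in regular_fourier_hypergroup) lebesgue_fourier_ideal:
  "function_ideal lebesgue_fourier fourier_space"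
  unfolding function_ideal_def
proof (intro conjI ballI)
  have A: "function_subspace fourier_space"
    and mult: "\<And>u v. u \<in> fourier_space \<Longrightarrow> v \<in> fourier_space \<Longrightarrow> (\<lambda>x. u x * v x) \<in> fourier_space"
    using fourier_algebra by (simp_all add: banach_function_algebra_def)
  show "lebesgue_fourier \<subseteq> fourier_space" by (auto simp: lebesgue_fourier_def)
  show "function_subspace lebesgue_fourier"
    using A L1_function_subspace by (simp add: function_subspace_def lebesgue_fourier_def)
  fix u v
  assume u: "u \<in> fourier_space" and v: "v \<in> lebesgue_fourier"
  have "u \<in> B_lambda" using u by (simp add: fourier_space_def)
  then show "(\<lambda>x. u x * v x) \<in> lebesgue_fourier"
    using B_lambda_mult_L1 mult[OF u] v by (simp add: lebesgue_fourier_def)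
qed

text \<open>
  The approximants in the definition of the Fourier space already lie in the intersection: they are
  continuous and integrable, and each is approximated by itself at distance \<open>B_norm 0 = 0\<close>.
\<close>
lemma (in regular_fourier_hypergroup) lebesgue_fourier_dense:
  "norm_dense B_norm lebesgue_fourier fourier_space"
  unfolding norm_dense_def
proof (intro conjI ballI allI impI)
  show "lebesgue_fourier \<subseteq> fourier_space" by (auto simp: lebesgue_fourier_def)
  have "(\<lambda>_. 0) \<in> fourier_space" "B_norm (\<lambda>_. 0) = 0"
    using fourier_algebra by (auto simp: banach_function_algebra_def function_subspace_def)
  then have span: "v \<in> lebesgue_fourier" if "v \<in> fourier_span \<inter> B_lambda" for v
    using that fourier_span_continuous_integrable[of v]
    by (auto simp: lebesgue_fourier_def fourier_space_def intro!: bexI[of _ v])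
  fix u and \<epsilon> :: real
  assume "u \<in> fourier_space" "0 < \<epsilon>"
  then show "\<exists>v\<in>lebesgue_fourier. B_norm (\<lambda>x. u x - v x) < \<epsilon>"
    using span by (force simp: fourier_space_def)
qed

theorem proposition3p2:
  fixes conv :: "('a::t2_space set \<Rightarrow> complex) \<Rightarrow> ('a set \<Rightarrow> complex) \<Rightarrow> 'a set \<Rightarrow> complex"
    and e :: 'a
    and invol :: "'a \<Rightarrow> 'a"
    and haar :: "'a measure"
  assumes "regular_fourier_hypergroup conv e invol haar"
  shows "function_ideal
           (haar_hypergroup.lebesgue_fourier conv invol haar)
           (haar_hypergroup.fourier_space conv invol haar)
       \<and> norm_dense
           (haar_hypergroup.B_norm conv invol haar)
           (haar_hypergroup.lebesgue_fourier conv invol haar)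
           (haar_hypergroup.fourier_space conv invol haar)"
proof -
  interpret regular_fourier_hypergroup conv e invol haar by fact
  show ?thesis
    using lebesgue_fourier_ideal lebesgue_fourier_dense by blast
qed

end
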